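(* Let $G$ be a connected graph with vertex set $X$. If $G$ is Ptolemaic, then there is no edge clique cover $K$ of $G$ with $K\neq K(G)$ and $|K|\le |K(G)|$. In particular, $\mathrm{ecc}(G)=|K(G)|$.
   Context: A graph is Ptolemaic if its shortest-path distance $d^*$ satisfies $d^*(x,y)d^*(z,u)+d^*(x,u)d^*(y,z)\ge d^*(x,z)d^*(y,u)$ for all vertices $x,y,z,u$. A clique is a set $Y$ of vertices with $|Y|\ge2$ that are pairwise adjacent; $K(G)$ is the set of maximal cliques of $G$. An edge clique cover of $G$ is a set $K$ of (not necessarily maximal) cliques of $G$ such that every edge of $G$ is contained in some member of $K$; $\mathrm{ecc}(G)$ is the minimum size of an edge clique cover of $G$. *)

theory Defs
  imports "Graph_Theory.Graph_Theory"
begin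

text \<open>
  A finite simple undirected graph is an instance of the locale \<open>graph\<close>: a finite digraph
  without loops and parallel arcs whose adjacency relation is symmetric, so that an edge
  \<open>{u, v}\<close> is represented by the two arcs \<open>(u, v)\<close> and \<open>(v, u)\<close>.
\<close>

text \<open>The distance is \<open>\<infinity>\<close> between vertices of different components.\<close>

definition graph_dist :: "('a, 'b) pre_digraph \<Rightarrow> 'a \<Rightarrow> 'a \<Rightarrow> ereal" where
  "graph_dist G u v = wf_digraph.\<mu> G (\<lambda>_. 1) u v"

definition ptolemaic :: "('a, 'b) pre_digraph \<Rightarrow> bool" where
  "ptolemaic G \<longleftrightarrow>
    (\<forall>x \<in> verts G. \<forall>y \<in> verts G. \<forall>z \<in> verts G. \<forall>u \<in> verts G.
      graph_dist G x y * graph_dist G z u + graph_dist G x u * graph_dist G y z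
        \<ge> graph_dist G x z * graph_dist G y u)"

definition clique :: "('a, 'b) pre_digraph \<Rightarrow> 'a set \<Rightarrow> bool" where
  "clique G Y \<longleftrightarrow>
    Y \<subseteq> verts G \<and> card Y \<ge> 2 \<and> (\<forall>u \<in> Y. \<forall>v \<in> Y. u \<noteq> v \<longrightarrow> u \<rightarrow>\<^bsub>G\<^esub> v)"

definition max_cliques :: "('a, 'b) pre_digraph \<Rightarrow> 'a set set" where
  "max_cliques G = {Y. clique G Y \<and> (\<forall>Z. clique G Z \<and> Y \<subseteq> Z \<longrightarrow> Z = Y)}"

definition edge_clique_cover :: "('a, 'b) pre_digraph \<Rightarrow> 'a set set \<Rightarrow> bool" where
  "edge_clique_cover G K \<longleftrightarrow>
    (\<forall>Y \<in> K. clique G Y) \<and> (\<forall>u v. u \<rightarrow>\<^bsub>G\<^esub> v \<longrightarrow> (\<exists>Y \<in> K. {u, v} \<subseteq> Y))"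

definition ecc :: "('a, 'b) pre_digraph \<Rightarrow> nat" where
  "ecc G = (LEAST n. \<exists>K. edge_clique_cover G K \<and> card K = n)"

end

theory Submission
  imports Defs
begin

text \<open>
  Two maximal cliques \<open>M\<^sub>1\<close>, \<open>M\<^sub>2\<close> that meet a maximal clique \<open>M\<close> in a common vertex have comparable
  traces on \<open>M\<close>: otherwise vertices \<open>a\<close>, \<open>b\<close> distinguishing the traces, together with \<open>c \<in> M\<^sub>1\<close> not
  adjacent to \<open>b\<close> and \<open>d \<in> M\<^sub>2\<close> not adjacent to \<open>a\<close>, violate the Ptolemaic inequality
  (they form an induced 4-cycle, or a gem with the common vertex). Taking a largest
  trace through \<open>a \<in> M\<close> and some \<open>b \<in> M\<close> outside it, one sees that every vertex \<open>a\<close> of \<open>M\<close> lies on an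
  edge \<open>ab\<close> that is contained in no maximal clique but \<open>M\<close>. Hence every edge clique cover has
  at least one member inside each maximal clique and inside no other one, and if it has no further
  members, these must be the maximal cliques themselves.
\<close>

lemma (in wf_digraph) graph_dist_nonneg: "0 \<le> graph_dist G u v"
  unfolding graph_dist_def \<mu>_def
  by (rule INF_greatest) (auto intro: pos_cost_pos_awalk_cost)

lemma (in wf_digraph) graph_dist_le_1:
  assumes "u \<rightarrow>\<^bsub>G\<^esub> v"
  shows "graph_dist G u v \<le> 1"
proof -
  from assms obtain e where "e \<in> arcs G" "tail G e = u" "head G e = v" by auto
  then have "awalk u [e] v" by (auto simp: awalk_simps)
  from min_cost_le_walk_cost[OF this, of "\<lambda>_. 1"] show ?thesis
    by (simp add: graph_dist_def one_ereal_def)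
qed

lemma (in wf_digraph) graph_dist_le_2:
  assumes "u \<rightarrow>\<^bsub>G\<^esub> w" "w \<rightarrow>\<^bsub>G\<^esub> v"
  shows "graph_dist G u v \<le> 2"
proof -
  from assms obtain e f where "e \<in> arcs G" "tail G e = u" "head G e = w"
    "f \<in> arcs G" "tail G f = w" "head G f = v" by (metis reachableE)
  then have "awalk u [e, f] v" by (auto simp: awalk_simps)
  from min_cost_le_walk_cost[OF this, of "\<lambda>_. 1"] show ?thesis
    by (simp add: graph_dist_def)
qed

lemma (in wf_digraph) graph_dist_ge_2:
  assumes "u \<noteq> v" "\<not> u \<rightarrow>\<^bsub>G\<^esub> v"
  shows "2 \<le> graph_dist G u v"
  unfolding graph_dist_def \<mu>_def
proof (rule INF_greatest)
  fix p assume "p \<in> {p. awalk u p v}"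
  then have p: "awalk u p v" by simp
  obtain e f q where pq: "p = e # f # q"
  proof (cases p rule: remdups_adj.cases)
    case 1
    with p assms show ?thesis by (auto simp: awalk_simps)
  next
    case (2 e)
    with p assms show ?thesis by (auto simp: awalk_simps arcs_ends_conv)
  next
    case (3 e f q)
    with that show ?thesis .
  qed
  with p have "awalk (head G f) q v" by (auto simp: awalk_simps)
  then have "0 \<le> awalk_cost (\<lambda>_. 1) q" by (rule pos_cost_pos_awalk_cost) simp
  with pq show "2 \<le> ereal (awalk_cost (\<lambda>_. 1) p)" by simp
qed

lemma (in wf_digraph) ptolemaic_middle_edge:
  assumes "ptolemaic G"
    and "c \<rightarrow>\<^bsub>G\<^esub> a" "a \<rightarrow>\<^bsub>G\<^esub> b" "b \<rightarrow>\<^bsub>G\<^esub> d" "c \<rightarrow>\<^bsub>G\<^esub> x" "x \<rightarrow>\<^bsub>G\<^esub> d"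
    and "c \<noteq> b" "a \<noteq> d"
  shows "c \<rightarrow>\<^bsub>G\<^esub> b \<or> a \<rightarrow>\<^bsub>G\<^esub> d"
proof (rule ccontr)
  assume "\<not> ?thesis"
  then have "2 \<le> graph_dist G c b" "2 \<le> graph_dist G a d"
    using assms graph_dist_ge_2 by auto
  then have "2 * 2 \<le> graph_dist G c b * graph_dist G a d"
    by (intro ereal_mult_mono) (auto simp: graph_dist_nonneg)
  also have "\<dots> \<le> graph_dist G c a * graph_dist G b d + graph_dist G c d * graph_dist G a b"
    using assms unfolding ptolemaic_def by (meson adj_in_verts)
  also have "\<dots> \<le> 1 * 1 + 2 * 1"
    using assms(2-4) graph_dist_le_2[OF assms(5,6)]
    by (intro add_mono ereal_mult_mono) (auto simp: graph_dist_nonneg intro: graph_dist_le_1)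
  finally show False by simp
qed

lemma clique_adj:
  assumes "clique G Y" "u \<in> Y" "v \<in> Y" "u \<noteq> v"
  shows "u \<rightarrow>\<^bsub>G\<^esub> v"
  using assms unfolding clique_def by blast

lemma max_cliques_clique: "M \<in> max_cliques G \<Longrightarrow> clique G M"
  unfolding max_cliques_def by blast

lemma max_cliques_subset_eq:
  assumes "M \<in> max_cliques G" "clique G N" "M \<subseteq> N"
  shows "N = M"
  using assms unfolding max_cliques_def by blast

context graph
begin

lemma finite_clique: "clique G Y \<Longrightarrow> finite Y"
  unfolding clique_def by (auto intro: finite_subset)

lemma finite_cliques: "finite {Y. clique G Y}"
  by (rule finite_subset[of _ "Pow (verts G)"]) (auto simp: clique_def)

lemma finite_max_cliques: "finite (max_cliques G)"
  by (rule finite_subset[OF _ finite_cliques]) (auto simp: max_cliques_clique)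

lemma finite_edge_clique_cover: "edge_clique_cover G K \<Longrightarrow> finite K"
  unfolding edge_clique_cover_def by (blast intro: finite_subset[OF _ finite_cliques])

lemma adj_sym: "u \<rightarrow>\<^bsub>G\<^esub> v \<Longrightarrow> v \<rightarrow>\<^bsub>G\<^esub> u"
  by (rule arcs_ends_symmetric[OF sym_arcs])

lemma clique_pair: "u \<rightarrow>\<^bsub>G\<^esub> v \<Longrightarrow> clique G {u, v}"
  unfolding clique_def using adj_sym adj_not_same by (auto simp: card_insert_if)

lemma clique_extends:
  assumes "clique G Y"
  obtains M where "M \<in> max_cliques G" "Y \<subseteq> M"
proof -
  let ?S = "{Z. clique G Z \<and> Y \<subseteq> Z}"
  have "finite ?S" by (rule finite_subset[OF _ finite_cliques]) auto
  moreover have "?S \<noteq> {}" using assms by blast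
  ultimately obtain M where "M \<in> ?S" "\<forall>Z \<in> ?S. M \<subseteq> Z \<longrightarrow> M = Z"
    using finite_has_maximal[of ?S] by auto
  then have "M \<in> max_cliques G" "Y \<subseteq> M" unfolding max_cliques_def by auto
  with that show ?thesis .
qed

lemma max_cliques_nonneighbour:
  assumes M: "M \<in> max_cliques G" and b: "b \<in> verts G" "b \<notin> M"
  obtains c where "c \<in> M" "\<not> c \<rightarrow>\<^bsub>G\<^esub> b"
proof (rule ccontr)
  assume "\<not> thesis"
  with that have adj: "\<forall>c \<in> M. c \<rightarrow>\<^bsub>G\<^esub> b" by blast
  have cl: "clique G M" using M by (rule max_cliques_clique)
  have "clique G (insert b M)"
    using cl b adj adj_sym finite_clique[OF cl]
    unfolding clique_def by (auto simp: card_insert_if)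
  from max_cliques_subset_eq[OF M this] b show False by blast
qed

lemma max_cliques_edge_cover: "edge_clique_cover G (max_cliques G)"
  unfolding edge_clique_cover_def
  by (meson max_cliques_clique clique_extends clique_pair)

lemma ptolemaic_traces_comparable:
  assumes ptol: "ptolemaic G"
    and M: "M \<in> max_cliques G" and M1: "M1 \<in> max_cliques G" and M2: "M2 \<in> max_cliques G"
    and x: "x \<in> M" "x \<in> M1" "x \<in> M2"
  shows "M \<inter> M1 \<subseteq> M \<inter> M2 \<or> M \<inter> M2 \<subseteq> M \<inter> M1"
proof (rule ccontr)
  assume "\<not> ?thesis"
  then obtain a b where a: "a \<in> M" "a \<in> M1" "a \<notin> M2" and b: "b \<in> M" "b \<in> M2" "b \<notin> M1"
    by blast
  note cl = max_cliques_clique[OF M] max_cliques_clique[OF M1] max_cliques_clique[OF M2]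
  have "a \<in> verts G" "b \<in> verts G" using cl a b unfolding clique_def by auto
  then obtain c d where c: "c \<in> M1" "\<not> c \<rightarrow>\<^bsub>G\<^esub> b" and d: "d \<in> M2" "\<not> d \<rightarrow>\<^bsub>G\<^esub> a"
    using max_cliques_nonneighbour M1 M2 a b by metis
  have ab: "a \<rightarrow>\<^bsub>G\<^esub> b" using clique_adj[OF cl(1)] a b by blast
  have xb: "x \<rightarrow>\<^bsub>G\<^esub> b" using clique_adj[OF cl(1)] x b by blast
  have xa: "x \<rightarrow>\<^bsub>G\<^esub> a" using clique_adj[OF cl(1)] x a by blast
  have "c \<rightarrow>\<^bsub>G\<^esub> a" "c \<rightarrow>\<^bsub>G\<^esub> x" using clique_adj[OF cl(2)] a c x ab xb by blast+
  moreover have "b \<rightarrow>\<^bsub>G\<^esub> d" "x \<rightarrow>\<^bsub>G\<^esub> d"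
    using clique_adj[OF cl(3)] b d x adj_sym[OF ab] xa by blast+
  moreover have "c \<noteq> b" "a \<noteq> d" using a b c d by auto
  ultimately show False
    using ptolemaic_middle_edge[OF ptol] ab c d adj_sym by blast
qed

lemma ptolemaic_private_edge:
  assumes ptol: "ptolemaic G" and M: "M \<in> max_cliques G" and a: "a \<in> M"
  obtains b where "a \<rightarrow>\<^bsub>G\<^esub> b" "\<And>N. N \<in> max_cliques G \<Longrightarrow> {a, b} \<subseteq> N \<longleftrightarrow> N = M"
proof -
  note cl = max_cliques_clique[OF M]
  let ?S = "{N \<in> max_cliques G. N \<noteq> M \<and> a \<in> N}"
  have "\<exists>b \<in> M. a \<noteq> b \<and> (\<forall>N \<in> max_cliques G. {a, b} \<subseteq> N \<longrightarrow> N = M)"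
  proof (cases "?S = {}")
    case True
    have "\<not> M \<subseteq> {a}"
      using cl card_mono[of "{a}" M] unfolding clique_def by auto
    then obtain b where "b \<in> M" "a \<noteq> b" by blast
    with True show ?thesis by auto
  next
    case False
    have fin: "finite ?S" using finite_max_cliques by simp
    obtain L where L: "L \<in> ?S"
      and L_Max: "Max ((\<lambda>N. card (M \<inter> N)) ` ?S) = card (M \<inter> L)"
      by (rule obtains_MAX[OF fin False])
    have max: "card (M \<inter> N) \<le> card (M \<inter> L)" if "N \<in> ?S" for N
      unfolding L_Max[symmetric] using fin that by (intro Max_ge finite_imageI imageI)
    from L have "\<not> M \<subseteq> L"
      using max_cliques_subset_eq[OF M] max_cliques_clique by blast
    then obtain b where b: "b \<in> M" "b \<notin> L" by blast
    have "N = M" if N: "N \<in> max_cliques G" "{a, b} \<subseteq> N" for N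
    proof (rule ccontr)
      assume "N \<noteq> M"
      have "M \<inter> L \<subset> M \<inter> N"
        using ptolemaic_traces_comparable[OF ptol M, of L N a] N L a b by blast
      then have "card (M \<inter> L) < card (M \<inter> N)"
        using finite_clique[OF cl] by (intro psubset_card_mono) auto
      with max[of N] N \<open>N \<noteq> M\<close> show False by auto
    qed
    moreover have "a \<noteq> b" using b L by auto
    ultimately show ?thesis using b(1) by auto
  qed
  then obtain b where b: "b \<in> M" "a \<noteq> b"
    and priv: "\<And>N. N \<in> max_cliques G \<Longrightarrow> {a, b} \<subseteq> N \<Longrightarrow> N = M" by auto
  show ?thesis
  proof (rule that[of b])
    show "a \<rightarrow>\<^bsub>G\<^esub> b" using clique_adj[OF cl a b] .
    show "{a, b} \<subseteq> N \<longleftrightarrow> N = M" if "N \<in> max_cliques G" for N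
      using priv[OF that] a b by auto
  qed
qed

lemma ptolemaic_cover_minimal:
  assumes ptol: "ptolemaic G" and K: "edge_clique_cover G K"
    and card: "card K \<le> card (max_cliques G)"
  shows "K = max_cliques G"
proof -
  have ex: "\<exists>Y \<in> K. a \<in> Y \<and> (\<forall>N \<in> max_cliques G. Y \<subseteq> N \<longleftrightarrow> N = M)"
    if M: "M \<in> max_cliques G" and a: "a \<in> M" for M a
  proof -
    obtain b where b: "a \<rightarrow>\<^bsub>G\<^esub> b" and priv: "\<And>N. N \<in> max_cliques G \<Longrightarrow> {a, b} \<subseteq> N \<longleftrightarrow> N = M"
      using ptolemaic_private_edge[OF ptol M a] by blast
    obtain Y where Y: "Y \<in> K" "{a, b} \<subseteq> Y"
      using K b unfolding edge_clique_cover_def by blast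
    then have "clique G Y" using K unfolding edge_clique_cover_def by blast
    then obtain L where L: "L \<in> max_cliques G" "Y \<subseteq> L" by (rule clique_extends)
    with Y priv have "L = M" by blast
    have "Y \<subseteq> N \<longleftrightarrow> N = M" if "N \<in> max_cliques G" for N
      using L Y priv[OF that] \<open>L = M\<close> by auto
    with Y show ?thesis by auto
  qed
  have "\<exists>Y \<in> K. \<forall>N \<in> max_cliques G. Y \<subseteq> N \<longleftrightarrow> N = M" if M: "M \<in> max_cliques G" for M
  proof -
    have "M \<noteq> {}" using max_cliques_clique[OF M] unfolding clique_def by auto
    with ex[OF M] show ?thesis by blast
  qed
  then obtain f where f: "\<And>M. M \<in> max_cliques G \<Longrightarrow> f M \<in> K"
    and f_sub: "\<And>M N. M \<in> max_cliques G \<Longrightarrow> N \<in> max_cliques G \<Longrightarrow> f M \<subseteq> N \<longleftrightarrow> N = M"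
    by metis
  have "inj_on f (max_cliques G)" by (rule inj_onI) (metis f_sub)
  then have "card (f ` max_cliques G) = card (max_cliques G)" by (rule card_image)
  then have onto: "f ` max_cliques G = K"
    using card f finite_edge_clique_cover[OF K] by (intro card_seteq) auto
  have "f M = M" if M: "M \<in> max_cliques G" for M
  proof
    show "f M \<subseteq> M" using f_sub M by blast
    show "M \<subseteq> f M"
    proof
      fix a assume "a \<in> M"
      from ex[OF M this] obtain Y
        where Y: "Y \<in> K" "a \<in> Y" and "\<forall>N \<in> max_cliques G. Y \<subseteq> N \<longleftrightarrow> N = M" by auto
      moreover obtain N where "N \<in> max_cliques G" "Y = f N" using onto Y by auto
      ultimately have "N = M" using f_sub by auto
      with Y \<open>Y = f N\<close> show "a \<in> f M" by simp
    qed
  qed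
  with onto show ?thesis by simp
qed

lemma ptolemaic_ecc:
  assumes "ptolemaic G"
  shows "ecc G = card (max_cliques G)"
  unfolding ecc_def
proof (rule Least_equality)
  show "\<exists>K. edge_clique_cover G K \<and> card K = card (max_cliques G)"
    using max_cliques_edge_cover by blast
  show "card (max_cliques G) \<le> n" if "\<exists>K. edge_clique_cover G K \<and> card K = n" for n
    using that ptolemaic_cover_minimal[OF assms] by (metis nat_le_linear)
qed

end

theorem theorem5p2:
  fixes G :: "('a, 'b) pre_digraph"
  assumes "graph G" and "Digraph_Component.connected G" and "ptolemaic G"
  shows "\<not> (\<exists>K. edge_clique_cover G K \<and> K \<noteq> max_cliques G \<and> card K \<le> card (max_cliques G))
    \<and> ecc G = card (max_cliques G)"
  using graph.ptolemaic_cover_minimal[OF assms(1,3)] graph.ptolemaic_ecc[OF assms(1,3)] by blast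

end
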